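(* Define a sequence $(b_n)_{n\ge 0}$ of real numbers by $b_0=0$, $b_1=1$ and, for all $n\ge 0$, $$b_{3n}=b_n,\qquad b_{3n+1}=\sqrt2\, b_n+b_{n+1},\qquad b_{3n+2}=b_n+\sqrt2\, b_{n+1}.$$ For $n\ge 1$ let $s_n=\dfrac{\sqrt2\, b_{n+1}}{b_n}$. Then every positive rational number equals $s_n$ for some $n\ge 1$.
   Context: The sequence begins $b_0,b_1,b_2,\dots = 0,1,\sqrt2,1,2\sqrt2,3,\sqrt2,3,2\sqrt2,1,3\sqrt2,5,\dots$; all $b_n$ with $n\ge1$ are positive. *)

theory Defs
  imports Complex_Main
begin

text \<open>
  The recurrences together with the initial values determine exactly one sequence, and its
  terms from index 1 on are positive; so the sequence may be introduced by hypotheses, and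
  the quotients of consecutive terms never divide by 0.
\<close>

definition bseq_spec :: "(nat \<Rightarrow> real) \<Rightarrow> bool" where
  "bseq_spec b \<longleftrightarrow> b 0 = 0 \<and> b 1 = 1 \<and>
    (\<forall>n. b (3 * n) = b n \<and>
         b (3 * n + 1) = sqrt 2 * b n + b (n + 1) \<and>
         b (3 * n + 2) = b n + sqrt 2 * b (n + 1))"

fun bseq :: "nat \<Rightarrow> real" where
  "bseq n =
    (if n \<le> 1 then real n
     else if n mod 3 = 0 then bseq (n div 3)
     else if n mod 3 = 1 then sqrt 2 * bseq (n div 3) + bseq (n div 3 + 1)
     else bseq (n div 3) + sqrt 2 * bseq (n div 3 + 1))"

declare bseq.simps [simp del]

lemma bseq_spec_bseq: "bseq_spec bseq"
proof -
  have z: "bseq 0 = 0" and o: "bseq 1 = 1"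
    by (simp_all add: bseq.simps)
  have r0: "bseq (3 * n) = bseq n" for n
    by (cases "n = 0") (simp_all add: bseq.simps [of "3 * n"])
  have r1: "bseq (3 * n + 1) = sqrt 2 * bseq n + bseq (n + 1)" for n
  proof (cases "n = 0")
    case True
    then show ?thesis using z by simp
  next
    case False
    have "(3 * n + 1) mod 3 = 1" "(3 * n + 1) div 3 = n" by presburger+
    with False show ?thesis by (subst bseq.simps) simp
  qed
  have r2: "bseq (3 * n + 2) = bseq n + sqrt 2 * bseq (n + 1)" for n
  proof -
    have "(3 * n + 2) mod 3 = 2" "(3 * n + 2) div 3 = n" by presburger+
    then show ?thesis by (subst bseq.simps) simp
  qed
  from z o r0 r1 r2 show ?thesis
    unfolding bseq_spec_def by blast
qed

lemma bseq_spec_cases: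
  fixes n :: nat
  obtains "n = 0" | "n = 1"
  | m where "n = 3 * m" "m < n" "m \<ge> 1"
  | m where "n = 3 * m + 1" "m + 1 < n" "m \<ge> 1"
  | m where "n = 3 * m + 2" "m + 1 < n"
proof -
  have "n = 0 \<or> n = 1 \<or> (\<exists>m. n = 3 * m \<and> m < n \<and> m \<ge> 1) \<or>
      (\<exists>m. n = 3 * m + 1 \<and> m + 1 < n \<and> m \<ge> 1) \<or> (\<exists>m. n = 3 * m + 2 \<and> m + 1 < n)"
    by presburger
  then show thesis using that by blast
qed

lemma bseq_spec_unique:
  assumes "bseq_spec b" "bseq_spec c"
  shows "b = c"
proof
  fix n
  show "b n = c n"
  proof (induction n rule: less_induct)
    case (less n)
    show ?case
    proof (cases n rule: bseq_spec_cases)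
      case (4 m)
      then have "b m = c m" "b (m + 1) = c (m + 1)" using less by simp_all
      with assms show ?thesis unfolding 4(1) bseq_spec_def by metis
    next
      case (5 m)
      then have "b m = c m" "b (m + 1) = c (m + 1)" using less by simp_all
      with assms show ?thesis unfolding 5(1) bseq_spec_def by metis
    qed (use assms less in \<open>simp_all add: bseq_spec_def\<close>)
  qed
qed

lemma bseq_spec_ex1: "\<exists>!b. bseq_spec b"
  using bseq_spec_bseq bseq_spec_unique by blast

lemma bseq_spec_pos:
  assumes "bseq_spec b"
  shows "n \<ge> 1 \<Longrightarrow> b n > 0"
proof (induction n rule: less_induct)
  case (less n)
  show ?case
  proof (cases n rule: bseq_spec_cases)
    case 1
    with less show ?thesis by simp
  next
    case 2
    with assms show ?thesis by (simp add: bseq_spec_def)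
  next
    case (3 m)
    then have "b m > 0" using less by simp
    with assms show ?thesis unfolding 3(1) bseq_spec_def by simp
  next
    case (4 m)
    then have "sqrt 2 * b m > 0" "b (m + 1) > 0" using less by simp_all
    moreover have "b n = sqrt 2 * b m + b (m + 1)"
      using assms unfolding 4(1) bseq_spec_def by blast
    ultimately show ?thesis by linarith
  next
    case (5 m)
    then have "sqrt 2 * b (m + 1) > 0" using less by simp
    moreover have "b m \<ge> 0"
    proof (cases "m = 0")
      case True
      then show ?thesis using assms by (simp add: bseq_spec_def)
    next
      case False
      then show ?thesis using less 5 by (simp add: less_imp_le)
    qed
    moreover have "b n = b m + sqrt 2 * b (m + 1)"
      using assms unfolding 5(1) bseq_spec_def by blast
    ultimately show ?thesis by linarith
  qed
qed

end

theory Submission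
  imports Defs
begin

text \<open>
  With \<open>t = s n\<close> one finds \<open>s (3n) = t + 2\<close>, \<open>s (3n+1) = 2(1+t)/(2+t)\<close> and
  \<open>s (3n+2) = t/(1+t)\<close>. These maps send the positive rationals bijectively onto those in
  \<open>(2,\<infinity>)\<close>, \<open>(1,2)\<close> and \<open>(0,1)\<close>; the two remaining values are \<open>s 1 = 2\<close> and \<open>s 2 = 1\<close>.
  Applying the appropriate inverse to \<open>p/q\<close> gives \<open>(p-2q)/q\<close>, \<open>(2p-2q)/(2q-p)\<close> or
  \<open>p/(q-p)\<close>, and in each case the sum of numerator and denominator drops.
\<close>

lemma bseq_spec_ratio_surj:
  assumes b: "bseq_spec b"
  shows "0 < p \<Longrightarrow> 0 < q \<Longrightarrow> \<exists>n\<ge>1. sqrt 2 * b (n + 1) * real q = real p * b n"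
\<comment> \<open>The pairs are not assumed coprime: for \<open>1 < p/q < 2\<close> and even
  \<open>p\<close>, the new pair \<open>(2p-2q, 2q-p)\<close> has common factor 2. Hence the
  induction runs over all positive pairs.\<close>
proof (induction "p + q" arbitrary: p q rule: less_induct)
  case less
  have b1: "b 1 = 1"
    and b3: "b (3 * n) = b n"
    and b31: "b (3 * n + 1) = sqrt 2 * b n + b (n + 1)"
    and b32: "b (3 * n + 2) = b n + sqrt 2 * b (n + 1)" for n
    using b unfolding bseq_spec_def by blast+
  have b33: "b (3 * n + 3) = b (n + 1)" for n
    using b3[of "n + 1"] by (simp add: algebra_simps)
  have b2: "b 2 = sqrt 2" "b 3 = 1"
    using b32[of 0] b33[of 0] b1 b by (simp_all add: bseq_spec_def numeral_2_eq_2)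
  have sq: "sqrt 2 * (sqrt 2 * z) = 2 * z" for z :: real
    by (simp flip: mult.assoc)
  consider "p = q" | "p = 2 * q" | "2 * q < p" | "q < p" "p < 2 * q" | "p < q"
    by linarith
  then show ?case
  proof cases
    case 1
    then show ?thesis using b2 by (intro exI[of _ 2]) simp
  next
    case 2
    then show ?thesis using b1 b2 by (intro exI[of _ 1]) (simp add: numeral_2_eq_2)
  next
    case 3
    then have "(p - 2 * q) + q < p + q" "0 < p - 2 * q" "0 < q"
      using less.prems by linarith+
    then obtain n where n: "n \<ge> 1" "sqrt 2 * b (n + 1) * real q = real (p - 2 * q) * b n"
      using less.hyps[of "p - 2 * q" q] by blast
    then have "sqrt 2 * b (3 * n + 1) * real q = real p * b (3 * n)"
      using 3 unfolding b31 b3 by (simp add: of_nat_diff algebra_simps sq)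
    with n(1) show ?thesis by (intro exI[of _ "3 * n"]) simp
  next
    case 4
    then have "(2 * p - 2 * q) + (2 * q - p) < p + q" "0 < 2 * p - 2 * q" "0 < 2 * q - p"
      using less.prems by linarith+
    then obtain n where n: "n \<ge> 1"
      "sqrt 2 * b (n + 1) * real (2 * q - p) = real (2 * p - 2 * q) * b n"
      using less.hyps[of "2 * p - 2 * q" "2 * q - p"] by blast
    \<comment> \<open>Writing 2 as \<open>sqrt 2 * sqrt 2\<close> lets one factor
      \<open>sqrt 2\<close> cancel; what remains is the goal for index \<open>3n+1\<close> expanded
      and rearranged.\<close>
    have "sqrt 2 * (b (n + 1) * real (2 * q - p)) = sqrt 2 * (sqrt 2 * ((real p - real q) * b n))"
      using n(2) 4 unfolding sq by (simp add: of_nat_diff algebra_simps)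
    then have "b (n + 1) * real (2 * q - p) = sqrt 2 * ((real p - real q) * b n)"
      by simp
    then have "sqrt 2 * b (3 * n + 2) * real q = real p * b (3 * n + 1)"
      using 4 unfolding b31 b32 by (simp add: of_nat_diff algebra_simps sq)
    with n(1) show ?thesis by (intro exI[of _ "3 * n + 1"]) simp
  next
    case 5
    then have "p + (q - p) < p + q" "0 < p" "0 < q - p"
      using less.prems by linarith+
    then obtain n where n: "n \<ge> 1" "sqrt 2 * b (n + 1) * real (q - p) = real p * b n"
      using less.hyps[of p "q - p"] by blast
    \<comment> \<open>The successor of \<open>3n+2\<close> opens the next block of three, so
      \<open>b33\<close> supplies its value.\<close>
    then have "sqrt 2 * b (3 * n + 3) * real q = real p * b (3 * n + 2)"
      using 5 unfolding b33 b32 by (simp add: of_nat_diff algebra_simps)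
    with n(1) show ?thesis
      by (intro exI[of _ "3 * n + 2"]) (simp add: numeral_3_eq_3)
  qed
qed

theorem theorem2:
  fixes b s :: "nat \<Rightarrow> real"
  assumes "b 0 = 0" and "b 1 = 1"
    and "\<And>n. b (3 * n) = b n"
    and "\<And>n. b (3 * n + 1) = sqrt 2 * b n + b (n + 1)"
    and "\<And>n. b (3 * n + 2) = b n + sqrt 2 * b (n + 1)"
    and "\<And>n. n \<ge> 1 \<Longrightarrow> s n = sqrt 2 * b (n + 1) / b n"
  shows "\<forall>q::rat. q > 0 \<longrightarrow> (\<exists>n\<ge>1. s n = of_rat q)"
proof (intro allI impI)
  fix r :: rat
  assume "r > 0"
  have b: "bseq_spec b"
    unfolding bseq_spec_def using assms(1-5) by blast
  obtain i j where r: "r = Fract i j" "j > 0"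
    by (cases r) auto
  with \<open>r > 0\<close> have "i > 0"
    by (simp add: zero_less_Fract_iff)
  then obtain n where n: "n \<ge> 1" "sqrt 2 * b (n + 1) * real (nat j) = real (nat i) * b n"
    using bseq_spec_ratio_surj[OF b, of "nat i" "nat j"] \<open>j > 0\<close> by auto
  \<comment> \<open>Positivity turns the cross-multiplied identity back into a quotient.\<close>
  have "b n > 0"
    using bseq_spec_pos[OF b] n(1) by simp
  then have "s n = of_int i / of_int j"
    using n \<open>i > 0\<close> \<open>j > 0\<close> by (simp add: assms(6) field_simps)
  then show "\<exists>n\<ge>1. s n = of_rat r"
    using n(1) r by (auto simp: of_rat_rat)
qed

end
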